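(* Let $\beta>\sqrt{2}$. Then the function $M_\beta$ is continuous on $[0,1)$. Furthermore, $M_\beta(\alpha)+M_\beta(1-\langle \beta+\alpha\rangle)=1$ for every $\alpha\in[0,1)$.
   Context: For a real number $r$, $\lfloor r\rfloor$ is its integer part and $\langle r\rangle=r-\lfloor r\rfloor$ its fractional part; $\lambda$ is Lebesgue measure. For $\beta>1$ and a real number $\alpha$, let $T_{\beta,\alpha}:[0,1]\to[0,1]$, $T_{\beta,\alpha}(x)=\beta x+\alpha-\lfloor\beta x+\alpha\rfloor$; $T_{\beta,\alpha}^n$ denotes the $n$-th iterate, with $T^0_{\beta,\alpha}$ the identity. Note that $T_{\beta,\alpha+1}=T_{\beta,\alpha}$. Define, for $x\in[0,1]$, $$\tilde g_{\beta,\alpha}(x)=\sum_{n\ge 0:\ x<T_{\beta,\alpha}^n(1)}\frac{1}{\beta^n}-\sum_{n\ge 0:\ x<T_{\beta,\alpha}^n(0)}\frac{1}{\beta^n},\qquad g_{\beta,\alpha}(x)=\frac{\tilde g_{\beta,\alpha}(x)}{\int_{[0,1]}\tilde g_{\beta,\alpha}\,d\lambda}.$$ By a theorem of Parry, $g_{\beta,\alpha}$ is the density of a $T_{\beta,\alpha}$-invariant probability measure on $[0,1]$. Define $M_\beta(\alpha)=\int_{[0,1]}x\,g_{\beta,\alpha}(x)\,d\lambda(x)$. Since $T_{\beta,\alpha+1}=T_{\beta,\alpha}$, one has $M_\beta(1)=M_\beta(0)$. *)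

theory Defs
  imports "HOL-Analysis.Analysis"
begin

text \<open>
  The map is written as a total function on the reals; it maps everything into \<open>{0..<1}\<close>, and
  only its restriction to \<open>{0..1}\<close> matters below. The library function \<^const>\<open>frac\<close> is
  \<open>x - \<lfloor>x\<rfloor>\<close>.
\<close>

definition T :: "real \<Rightarrow> real \<Rightarrow> real \<Rightarrow> real" where
  "T \<beta> \<alpha> x = frac (\<beta> * x + \<alpha>)"

text \<open>
  Both sums are subsums of a geometric series, hence summable for \<open>\<beta> > 1\<close>. The orbit of \<open>1\<close>
  starts at \<open>1\<close> itself (the \<open>0\<close>-th iterate is the identity), not at \<open>0\<close>.
\<close>

definition g_tilde :: "real \<Rightarrow> real \<Rightarrow> real \<Rightarrow> real" where
  "g_tilde \<beta> \<alpha> x =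
     (\<Sum>\<^sub>\<infinity>n\<in>{n. x < (T \<beta> \<alpha> ^^ n) 1}. 1 / \<beta> ^ n) -
     (\<Sum>\<^sub>\<infinity>n\<in>{n. x < (T \<beta> \<alpha> ^^ n) 0}. 1 / \<beta> ^ n)"

definition g :: "real \<Rightarrow> real \<Rightarrow> real \<Rightarrow> real" where
  "g \<beta> \<alpha> x = g_tilde \<beta> \<alpha> x / (LINT y:{0..1}|lebesgue. g_tilde \<beta> \<alpha> y)"

definition M :: "real \<Rightarrow> real \<Rightarrow> real" where
  "M \<beta> \<alpha> = (LINT x:{0..1}|lebesgue. x * g \<beta> \<alpha> x)"

end

theory Submission
  imports Defs
begin

text \<open>
  Write \<open>T\<close> for \<open>T \<beta> \<alpha>\<close>, \<open>a\<^sub>n = T\<^sup>n(1)\<close> and \<open>b\<^sub>n = T\<^sup>n(0)\<close>. Integrating the series for \<^const>\<open>g_tilde\<close>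
  term by term turns \<^const>\<open>M\<close> into the ratio \<open>G\<^sub>2 / (2 G\<^sub>1)\<close>, where \<open>G\<^sub>k = \<Sum>\<^sub>n (a\<^sub>n\<^sup>k - b\<^sub>n\<^sup>k) / \<beta>\<^sup>n\<close>
  (\<open>M_eq_orbit_gap_ratio\<close>), so no ergodic theory enters: both claims are about two series in
  the orbits of the end points.

  The first difficulty is \<open>G\<^sub>1 > 0\<close> (\<open>orbit_gap_1_pos\<close>). Individual terms can be negative, so one
  compares with the measures \<open>q\<^sub>n\<close> of the sets of points of \<open>[0,1)\<close> whose \<open>n\<close>-th iterate lies in a short
  interval \<open>[x,1)\<close>. Splitting these sets along the branches of \<open>T\<close> gives the renewal
  identity \<open>\<Sum>\<^sub>j\<^sub>\<le>\<^sub>n r\<^sub>j q\<^sub>n\<^sub>-\<^sub>j = \<Sum>\<^sub>j\<^sub>\<le>\<^sub>n e\<^sub>j\<close> with \<open>r\<^sub>j = (a\<^sub>j - b\<^sub>j) / \<beta>\<^sup>j\<close>, where \<open>e\<^sub>j\<close> is \<open>\<beta>\<^sup>-\<^sup>j\<close> times the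
  difference of the lengths of \<open>[0,a\<^sub>j) \<inter> [x,1)\<close> and \<open>[0,b\<^sub>j) \<inter> [x,1)\<close>. For \<open>x\<close> close to \<open>1\<close> the term \<open>e\<^sub>0 = 1 - x\<close>
  dominates the right-hand side, which therefore stays above a positive constant. As
  \<open>0 \<le> q\<^sub>n \<le> 1\<close>, averaging over \<open>n\<close> forces \<open>\<Sum> r\<^sub>j > 0\<close>.

  The second difficulty is that orbits jump, as functions of \<open>\<alpha>\<close>, when they hit a discontinuity
  of \<open>T\<close>, that is, when they return to \<open>0\<close>. From the right the orbits converge to the orbits
  of \<open>T\<close>; from the left they converge to the orbits of the left-continuous version \<open>T_left\<close>, which
  takes the value \<open>1\<close> where \<open>T\<close> takes the value \<open>0\<close>. The two versions may produce different values of \<open>G\<^sub>k\<close>,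
  but after a return to \<open>0\<close> a series repeats itself with a geometric factor, and this makes the
  two values proportional with a positive factor that is the same for all \<open>k\<close>
  (\<open>orbit_gaps_proportional\<close>). Hence the ratio \<open>G\<^sub>2 / (2 G\<^sub>1)\<close> does not see the jump, and \<open>M\<close> is
  continuous.

  The same fact gives the symmetry: the reflection \<open>x \<mapsto> 1 - x\<close> conjugates \<open>T_left\<close> for \<open>\<alpha>\<close> to \<open>T\<close>
  for \<open>1 - \<langle>\<beta> + \<alpha>\<rangle>\<close>, which replaces \<open>G\<^sub>1\<close> by \<open>G\<^sub>1\<close> and \<open>G\<^sub>2\<close> by \<open>2 G\<^sub>1 - G\<^sub>2\<close>, hence the ratio \<open>M\<close> by \<open>1 - M\<close>.
\<close>

section \<open>A renewal criterion for positivity of a series\<close>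

text \<open>
  With \<open>Q\<^sub>m = q\<^sub>0 + \<dots> + q\<^sub>m\<^sub>-\<^sub>1\<close>, adding up the convolutions for \<open>n < N\<close> gives \<open>\<Sum>\<^sub>j r\<^sub>j Q\<^sub>N\<^sub>-\<^sub>j\<close>, and
  replacing each \<open>Q\<^sub>N\<^sub>-\<^sub>j\<close> by \<open>Q\<^sub>N\<close> costs at most \<open>j\<close> times \<open>\<bar>r\<^sub>j\<bar>\<close>. So \<open>Q\<^sub>N\<close> times the full sum of \<open>r\<close> is at
  least \<open>N \<epsilon>\<close> minus a constant, which is impossible for large \<open>N\<close> if the sum is not positive.
\<close>
lemma suminf_pos_of_renewal:
  fixes r q :: "nat \<Rightarrow> real"
  assumes r: "summable (\<lambda>j. real j * \<bar>r j\<bar>)"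
    and q: "\<And>n. 0 \<le> q n" "\<And>n. q n \<le> 1"
    and \<epsilon>: "0 < \<epsilon>" and conv: "\<And>n. \<epsilon> \<le> (\<Sum>j\<le>n. r j * q (n - j))"
  shows "0 < suminf r"
proof (rule ccontr)
  assume neg: "\<not> 0 < suminf r"
  define Q where "Q m = (\<Sum>i<m. q i)" for m
  define C where "C = (\<Sum>j. real j * \<bar>r j\<bar>)"
  have "\<bar>r j\<bar> \<le> real j * \<bar>r j\<bar>" if "1 \<le> j" for j
    using that by (intro mult_right_mono[of 1 "real j" "\<bar>r j\<bar>", simplified]) auto
  then have "summable (\<lambda>j. \<bar>r j\<bar>)"
    by (intro summable_comparison_test'[OF r, of 1]) auto
  then have sr: "summable r"
    by (rule summable_rabs_cancel)
  have W: "(\<Sum>n<N. \<Sum>j\<le>n. r j * q (n - j)) = (\<Sum>j<N. r j * Q (N - j))" for N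
  proof (induction N)
    case (Suc N)
    have "(\<Sum>j<Suc N. r j * Q (Suc N - j)) = (\<Sum>j<Suc N. r j * Q (N - j) + r j * q (N - j))"
      by (intro sum.cong) (auto simp: Q_def Suc_diff_le algebra_simps less_Suc_eq_le)
    also have "\<dots> = (\<Sum>j<N. r j * Q (N - j)) + (\<Sum>j\<le>N. r j * q (N - j))"
      by (simp add: sum.distrib Q_def lessThan_Suc_atMost[symmetric] del: sum.lessThan_Suc)
         (simp add: Q_def)
    finally show ?case
      using Suc by simp
  qed simp
  have Qdiff: "0 \<le> Q N - Q (N - j) \<and> Q N - Q (N - j) \<le> real j" for N j
  proof -
    have "Q N - Q (N - j) = sum q ({..<N} - {..<N - j})"
      unfolding Q_def by (subst sum_diff) auto
    also have "{..<N} - {..<N - j} = {N - j..<N}"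
      by auto
    finally have eq: "Q N - Q (N - j) = sum q {N - j..<N}" .
    have "sum q {N - j..<N} \<le> real (card {N - j..<N}) * 1"
      by (intro sum_bounded_above q)
    also have "\<dots> \<le> real j"
      by simp
    finally show ?thesis
      using eq q by (simp add: sum_nonneg)
  qed
  have bound: "real N * \<epsilon> \<le> C" for N
  proof -
    have "real N * \<epsilon> \<le> (\<Sum>n<N. \<Sum>j\<le>n. r j * q (n - j))"
      using sum_bounded_below[of "{..<N}" \<epsilon> "\<lambda>n. \<Sum>j\<le>n. r j * q (n - j)"] conv by simp
    also have "\<dots> = (\<Sum>j. r j * Q (N - j))"
      unfolding W by (rule suminf_finite[symmetric]) (auto simp: Q_def)
    also have "\<dots> \<le> (\<Sum>j. real j * \<bar>r j\<bar> + r j * Q N)"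
    proof (rule suminf_le)
      fix j
      have "r j * (Q (N - j) - Q N) \<le> \<bar>r j\<bar> * \<bar>Q (N - j) - Q N\<bar>"
        by (metis abs_ge_self abs_mult)
      also have "\<dots> \<le> \<bar>r j\<bar> * real j"
        using Qdiff[of N j] by (intro mult_left_mono) auto
      finally show "r j * Q (N - j) \<le> real j * \<bar>r j\<bar> + r j * Q N"
        by (simp add: algebra_simps)
    next
      show "summable (\<lambda>j. r j * Q (N - j))"
        by (rule summable_finite[of "{..<N}"]) (auto simp: Q_def)
      show "summable (\<lambda>j. real j * \<bar>r j\<bar> + r j * Q N)"
        by (intro summable_add r summable_mult2 sr)
    qed
    also have "\<dots> = C + suminf r * Q N"
      unfolding C_def by (subst suminf_add[symmetric]) (auto intro!: r summable_mult2 sr simp: suminf_mult2[OF sr])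
    also have "\<dots> \<le> C"
      using neg q by (simp add: Q_def mult_nonpos_nonneg sum_nonneg)
    finally show ?thesis .
  qed
  obtain N where "C / \<epsilon> < real N"
    using reals_Archimedean2 by blast
  with bound[of N] \<epsilon> show False
    by (simp add: field_simps)
qed

section \<open>Orbits stay in the unit interval\<close>

lemma funpow_in_invariant:
  assumes "\<And>y. y \<in> X \<Longrightarrow> S y \<in> X" "x \<in> X"
  shows "(S ^^ n) x \<in> X"
  using assms by (induction n) auto

lemma T_bounds: "0 \<le> T \<beta> \<alpha> x" "T \<beta> \<alpha> x < 1"
  by (auto simp: T_def frac_lt_1)

lemma T_orbit_bounds:
  assumes "x \<in> {0..1}"
  shows "0 \<le> (T \<beta> \<alpha> ^^ n) x" "(T \<beta> \<alpha> ^^ n) x \<le> 1"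
  using funpow_in_invariant[of "{0..1}" "T \<beta> \<alpha>" x n] assms T_bounds[of \<beta> \<alpha>] 
  by (force intro: less_imp_le)+

section \<open>Preimages of a terminal interval and the renewal identity\<close>

text \<open>
  The extension of \<open>F\<close> from \<open>[0,1]\<close> to the line with increment \<open>F 1\<close> over each unit interval: if
  \<open>F a\<close> is the measure of \<open>A \<inter> [0,a)\<close>, then increments of \<open>lift F\<close> are measures of pieces of the
  periodic set \<open>A + \<int>\<close>.
\<close>
definition lift :: "(real \<Rightarrow> real) \<Rightarrow> real \<Rightarrow> real" where
  "lift F u = of_int \<lfloor>u\<rfloor> * F 1 + F (frac u)"

text \<open>
  These are the functions \<open>a \<mapsto> \<mu>[0,a)\<close> for measures \<open>\<mu>\<close> on \<open>[0,1)\<close> with a density between \<open>0\<close> and \<open>1\<close>.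
\<close>
definition increments_bounded :: "(real \<Rightarrow> real) \<Rightarrow> bool" where
  "increments_bounded F \<longleftrightarrow> F 0 = 0 \<and> (\<forall>a b. 0 \<le> a \<longrightarrow> a \<le> b \<longrightarrow> b \<le> 1 \<longrightarrow> 0 \<le> F b - F a \<and> F b - F a \<le> b - a)"

lemma increments_boundedD:
  assumes "increments_bounded F" "0 \<le> a" "a \<le> b" "b \<le> 1"
  shows "0 \<le> F b - F a" "F b - F a \<le> b - a"
  using assms by (auto simp: increments_bounded_def)

text \<open>
  Between points of different unit intervals the increment of the lift decomposes into full
  periods and two partial ones, each bounded by the length it lives on.
\<close>
lemma lift_increments:
  assumes F: "increments_bounded F" and "u \<le> v"
  shows "0 \<le> lift F v - lift F u \<and> lift F v - lift F u \<le> v - u"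
proof (cases "\<lfloor>u\<rfloor> = \<lfloor>v\<rfloor>")
  case True
  then have "frac v - frac u = v - u" "frac u \<le> frac v" "frac v \<le> 1" 
    using \<open>u \<le> v\<close> frac_lt_1[of v] by (auto simp: frac_def)
  then show ?thesis
    using increments_boundedD[OF F frac_ge_0, of u "frac v"] True by (simp add: lift_def)
next
  case False
  define k where "k = of_int \<lfloor>v\<rfloor> - of_int \<lfloor>u\<rfloor> - (1::real)"
  have "\<lfloor>u\<rfloor> < \<lfloor>v\<rfloor>"
    using False floor_mono[OF \<open>u \<le> v\<close>] by simp
  then have k: "0 \<le> k"
    unfolding k_def by linarith
  have F0: "F 0 = 0"
    using F by (simp add: increments_bounded_def)
  have vu: "v - u = k + frac v + (1 - frac u)"
    by (simp add: k_def frac_def)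
  have dec: "lift F v - lift F u = k * F 1 + (F (frac v) - F 0) + (F 1 - F (frac u))"
    by (simp add: lift_def k_def F0 algebra_simps)
  have "0 \<le> F 1" "F 1 \<le> 1"
    using increments_boundedD[OF F, of 0 1] F0 by auto
  then have "0 \<le> k * F 1" "k * F 1 \<le> k"
    using k by (auto intro: mult_left_le)
  moreover have "0 \<le> F (frac v) - F 0" "F (frac v) - F 0 \<le> frac v"
      "0 \<le> F 1 - F (frac u)" "F 1 - F (frac u) \<le> 1 - frac u"
    using increments_boundedD[OF F, of 0 "frac v"] increments_boundedD[OF F, of "frac u" 1] frac_lt_1[of u] frac_lt_1[of v]
    by auto
  ultimately show ?thesis
    unfolding dec vu by linarith
qed

text \<open>
  For \<open>0 \<le> a \<le> 1\<close> and \<open>0 \<le> x \<le> 1\<close> this is the Lebesgue measure of the set of all \<open>y\<close> in \<open>[0,a)\<close> with \<open>T\<^sup>n(y)\<close> in \<open>[x,1)\<close>.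
  The recursion is the substitution \<open>u = \<beta> y + \<alpha>\<close>, under which \<open>[0,a)\<close> becomes \<open>[\<alpha>, \<beta> a + \<alpha>)\<close>
  and \<open>T y\<close> becomes the fractional part of \<open>u\<close>. Taking it as the definition
  keeps the argument free of measure theory.
\<close>
primrec preimage_measure :: "real \<Rightarrow> real \<Rightarrow> real \<Rightarrow> nat \<Rightarrow> real \<Rightarrow> real" where
  "preimage_measure \<beta> \<alpha> x 0 a = max 0 (a - x)"
| "preimage_measure \<beta> \<alpha> x (Suc n) a =
     (lift (preimage_measure \<beta> \<alpha> x n) (\<beta> * a + \<alpha>) - lift (preimage_measure \<beta> \<alpha> x n) \<alpha>) / \<beta>"

lemma preimage_measure_increments:
  assumes "1 < \<beta>" "0 \<le> x"
  shows "increments_bounded (preimage_measure \<beta> \<alpha> x n)"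
proof (induction n)
  case 0
  then show ?case
    using assms by (auto simp: increments_bounded_def)
next
  case (Suc n)
  let ?F = "preimage_measure \<beta> \<alpha> x n"
  have "0 \<le> lift ?F (\<beta> * b + \<alpha>) - lift ?F (\<beta> * a + \<alpha>) \<and>
      lift ?F (\<beta> * b + \<alpha>) - lift ?F (\<beta> * a + \<alpha>) \<le> \<beta> * (b - a)" if "a \<le> b" for a b
    using lift_increments[OF Suc, of "\<beta> * a + \<alpha>" "\<beta> * b + \<alpha>"] that assms
    by (simp add: right_diff_distrib)
  then show ?case
    using assms by (auto simp: increments_bounded_def field_simps)
qed

text \<open>
  The factor \<open>\<beta> (a - b) - (T a - T b)\<close> is the difference of the integer parts
  \<open>\<lfloor>\<beta> a + \<alpha>\<rfloor> - \<lfloor>\<beta> b + \<alpha>\<rfloor>\<close>; each unit of it is a full period of the lift.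
\<close>
lemma preimage_measure_diff:
  "preimage_measure \<beta> \<alpha> x (Suc n) a - preimage_measure \<beta> \<alpha> x (Suc n) b =
    ((\<beta> * (a - b) - (T \<beta> \<alpha> a - T \<beta> \<alpha> b)) * preimage_measure \<beta> \<alpha> x n 1
      + (preimage_measure \<beta> \<alpha> x n (T \<beta> \<alpha> a) - preimage_measure \<beta> \<alpha> x n (T \<beta> \<alpha> b))) / \<beta>"
proof -
  have "lift F (\<beta> * c + \<alpha>) = (\<beta> * c + \<alpha> - T \<beta> \<alpha> c) * F 1 + F (T \<beta> \<alpha> c)" for F c
    by (simp add: lift_def T_def frac_def)
  then show ?thesis
    unfolding preimage_measure.simps(2) by (simp only:) (simp add: diff_divide_distrib[symmetric] algebra_simps)
qed

definition gap :: "real \<Rightarrow> real \<Rightarrow> nat \<Rightarrow> real" where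
  "gap \<beta> \<alpha> n = ((T \<beta> \<alpha> ^^ n) 1 - (T \<beta> \<alpha> ^^ n) 0) / \<beta> ^ n"

text \<open>
  Iterating \<open>preimage_measure_diff\<close> along the two orbits: the difference of integer parts at
  step \<open>j\<close>, weighted by \<open>\<beta>\<^sup>-\<^sup>j\<^sup>-\<^sup>1\<close>, is the drop of \<^const>\<open>gap\<close> from \<open>j\<close> to \<open>j + 1\<close>.
\<close>
lemma preimage_measure_expand:
  fixes \<alpha> x :: real
  assumes "1 < \<beta>"
  defines "F \<equiv> preimage_measure \<beta> \<alpha> x"
  shows "(F n ((T \<beta> \<alpha> ^^ j) 1) - F n ((T \<beta> \<alpha> ^^ j) 0)) / \<beta> ^ j =
    (\<Sum>i<n. (gap \<beta> \<alpha> (j + i) - gap \<beta> \<alpha> (Suc (j + i))) * F (n - Suc i) 1)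
    + (F 0 ((T \<beta> \<alpha> ^^ (j + n)) 1) - F 0 ((T \<beta> \<alpha> ^^ (j + n)) 0)) / \<beta> ^ (j + n)"
proof (induction n arbitrary: j)
  case (Suc n)
  have "(F (Suc n) ((T \<beta> \<alpha> ^^ j) 1) - F (Suc n) ((T \<beta> \<alpha> ^^ j) 0)) / \<beta> ^ j =
      (gap \<beta> \<alpha> j - gap \<beta> \<alpha> (Suc j)) * F n 1
      + (F n ((T \<beta> \<alpha> ^^ Suc j) 1) - F n ((T \<beta> \<alpha> ^^ Suc j) 0)) / \<beta> ^ Suc j"
    unfolding F_def preimage_measure_diff using assms(1) by (simp add: gap_def field_simps)
  also have "\<dots> = (\<Sum>i<Suc n. (gap \<beta> \<alpha> (j + i) - gap \<beta> \<alpha> (Suc (j + i))) * F (Suc n - Suc i) 1)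
    + (F 0 ((T \<beta> \<alpha> ^^ (j + Suc n)) 1) - F 0 ((T \<beta> \<alpha> ^^ (j + Suc n)) 0)) / \<beta> ^ (j + Suc n)"
    unfolding Suc[of "Suc j"] by (subst sum.lessThan_Suc_shift) simp
  finally show ?case .
qed simp

text \<open>
  Summation by parts in \<open>preimage_measure_expand\<close> for \<open>j = 0\<close>: since \<open>gap \<beta> \<alpha> 0 = 1\<close>, consecutive
  left-hand sides differ by exactly one boundary term.
\<close>
lemma renewal_equation:
  fixes \<alpha> x :: real
  assumes "1 < \<beta>" "0 \<le> x"
  defines "F \<equiv> preimage_measure \<beta> \<alpha> x"
  shows "(\<Sum>j\<le>n. gap \<beta> \<alpha> j * F (n - j) 1) =
    (\<Sum>j\<le>n. (F 0 ((T \<beta> \<alpha> ^^ j) 1) - F 0 ((T \<beta> \<alpha> ^^ j) 0)) / \<beta> ^ j)"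
proof (induction n)
  case 0
  show ?case using assms by (simp add: gap_def)
next
  case (Suc n)
  have "F (Suc n) 0 = 0"
    using preimage_measure_increments[OF assms(1,2), of \<alpha> "Suc n"] by (simp add: F_def increments_bounded_def)
  then have q: "F (Suc n) 1 = (\<Sum>i\<le>n. (gap \<beta> \<alpha> i - gap \<beta> \<alpha> (Suc i)) * F (n - i) 1)
      + (F 0 ((T \<beta> \<alpha> ^^ Suc n) 1) - F 0 ((T \<beta> \<alpha> ^^ Suc n) 0)) / \<beta> ^ Suc n"
    using preimage_measure_expand[OF assms(1), of \<alpha> x "Suc n" 0]
    unfolding F_def[symmetric] lessThan_Suc_atMost by simp
  have "(\<Sum>j\<le>Suc n. gap \<beta> \<alpha> j * F (Suc n - j) 1) =
      F (Suc n) 1 + (\<Sum>j\<le>n. gap \<beta> \<alpha> (Suc j) * F (n - j) 1)"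
    by (subst sum.atMost_Suc_shift) (simp add: gap_def)
  also have "\<dots> = (\<Sum>j\<le>n. gap \<beta> \<alpha> j * F (n - j) 1)
      + (F 0 ((T \<beta> \<alpha> ^^ Suc n) 1) - F 0 ((T \<beta> \<alpha> ^^ Suc n) 0)) / \<beta> ^ Suc n"
    unfolding q by (simp add: left_diff_distrib sum_subtractf)
  finally show ?case
    using Suc by simp
qed

text \<open>
  The interval \<open>[x,1)\<close> is chosen so short that \<open>b\<^sub>j \<le> x\<close> for all \<open>j \<le> m\<close>, which is possible
  because \<open>b\<^sub>j < 1\<close>. Then the boundary terms of the renewal identity are \<open>1 - x\<close> for \<open>j = 0\<close>,
  nonnegative for \<open>0 < j < m\<close>, and at least \<open>-(1 - x) \<beta>\<^sup>-\<^sup>j\<close> for \<open>j \<ge> m\<close>. With \<open>m\<close> so large that the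
  geometric tail is below \<open>1/2\<close>, their partial sums never fall below \<open>(1 - x)/2\<close>.
\<close>
lemma suminf_gap_pos:
  assumes "1 < \<beta>"
  shows "0 < (\<Sum>n. gap \<beta> \<alpha> n)"
proof -
  let ?a = "\<lambda>n. (T \<beta> \<alpha> ^^ n) 1" and ?b = "\<lambda>n. (T \<beta> \<alpha> ^^ n) 0"
  have geo: "summable (\<lambda>n. (1 / \<beta>) ^ n)"
    using assms by (intro summable_geometric) auto
  obtain m0 where m0: "\<And>n. m0 \<le> n \<Longrightarrow> norm (\<Sum>i. (1 / \<beta>) ^ (i + n)) < 1 / 2"
    using suminf_exist_split[OF _ geo, of "1/2"] by auto
  \<comment> \<open>The successor makes \<open>m\<close> positive, so that the dominant term \<open>j = 0\<close> stays outside the tail.\<close>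
  define m where "m = Suc m0"
  have tail: "(\<Sum>i. (1 / \<beta>) ^ (i + m)) < 1 / 2"
    using m0[of m] by (auto simp: m_def)
  have b1: "?b j < 1" for j
    by (cases j) (auto simp: T_bounds)
  define x where "x = Max (?b ` {..m})"
  have xb: "?b j \<le> x" if "j \<le> m" for j
    unfolding x_def using that by (intro Max_ge) auto
  have x: "0 \<le> x" "x < 1"
    using xb[of 0] b1 by (auto simp: x_def)
  let ?F = "preimage_measure \<beta> \<alpha> x"
  define e where "e j = (?F 0 (?a j) - ?F 0 (?b j)) / \<beta> ^ j" for j
  \<comment> \<open>A lower bound for the boundary terms that depends on the orbits only through \<open>x\<close> and \<open>m\<close>.\<close>
  define l where "l j = (if j = 0 then 1 - x else if j < m then 0 else - (1 - x) * (1 / \<beta>) ^ j)" for j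
  have le: "l j \<le> e j" for j
  proof -
    consider "j = 0" | "0 < j" "j < m" | "m \<le> j" by linarith
    then show ?thesis
    proof cases
      case 1
      then show ?thesis using x by (simp add: l_def e_def)
    next
      case 2
      then show ?thesis using xb[of j] assms by (simp add: l_def e_def)
    next
      case 3
      have "- (1 - x) \<le> ?F 0 (?a j) - ?F 0 (?b j)"
        using b1[of j] x by auto
      then show ?thesis
        using 3 assms by (simp add: l_def e_def m_def power_one_over divide_simps)
    qed
  qed
  have "(1 - x) / 2 \<le> (\<Sum>j\<le>n. e j)" for n
  proof -
    have "(1 - x) / 2 \<le> (1 - x) - (1 - x) * (\<Sum>i. (1 / \<beta>) ^ (i + m))"
    proof -
      have "(1 - x) * (\<Sum>i. (1 / \<beta>) ^ (i + m)) \<le> (1 - x) * (1 / 2)"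
        using tail x by (intro mult_left_mono) auto
      then show ?thesis by argo
    qed
    also have "\<dots> \<le> (1 - x) - (1 - x) * (\<Sum>j\<in>{m..n}. (1 / \<beta>) ^ j)"
    proof -
      have "(\<Sum>j\<in>{m..n}. (1 / \<beta>) ^ j) \<le> (\<Sum>j<Suc n. (1 / \<beta>) ^ (j + m))"
      proof -
        have "(\<Sum>j\<in>{m..n}. (1 / \<beta>) ^ j) \<le> (\<Sum>j\<in>{0+m..<Suc n+m}. (1 / \<beta>) ^ j)"
          using assms by (intro sum_mono2) auto
        also have "\<dots> = (\<Sum>j<Suc n. (1 / \<beta>) ^ (j + m))"
          by (subst sum.shift_bounds_nat_ivl) (simp add: lessThan_atLeast0)
        finally show ?thesis .
      qed
      also have "\<dots> \<le> (\<Sum>i. (1 / \<beta>) ^ (i + m))"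
        using assms geo by (intro sum_le_suminf summable_ignore_initial_segment) auto
      finally show ?thesis using x by (intro diff_left_mono mult_left_mono) auto
    qed
    also have "\<dots> = (\<Sum>j\<le>n. l j)"
    proof -
      have "l j = (if j = 0 then 1 - x else 0) + (if m \<le> j then - (1 - x) * (1 / \<beta>) ^ j else 0)" for j
        by (auto simp: l_def m_def)
      then have "(\<Sum>j\<le>n. l j) = (\<Sum>j\<le>n. if j = 0 then 1 - x else 0)
          + (\<Sum>j\<le>n. if m \<le> j then - (1 - x) * (1 / \<beta>) ^ j else 0)"
        by (simp add: sum.distrib)
      also have "(\<Sum>j\<le>n. if m \<le> j then - (1 - x) * (1 / \<beta>) ^ j else 0) = (\<Sum>j\<in>{m..n}. - (1 - x) * (1 / \<beta>) ^ j)"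
        by (rule sum.mono_neutral_cong_right) auto
      also have "\<dots> = - (1 - x) * (\<Sum>j\<in>{m..n}. (1 / \<beta>) ^ j)"
        by (rule sum_distrib_left[symmetric])
      finally show ?thesis by (simp add: algebra_simps)
    qed
    also have "\<dots> \<le> (\<Sum>j\<le>n. e j)"
      by (intro sum_mono le)
    finally show ?thesis .
  qed
  then have conv: "(1 - x) / 2 \<le> (\<Sum>j\<le>n. gap \<beta> \<alpha> j * ?F (n - j) 1)" for n
    using renewal_equation[OF assms x(1), of \<alpha> n] by (simp add: e_def)
  have q: "0 \<le> ?F n 1 \<and> ?F n 1 \<le> 1" for n
    using preimage_measure_increments[OF assms x(1), of \<alpha> n] increments_boundedD[of "?F n" 0 1]
    by (auto simp: increments_bounded_def)
  have "summable (\<lambda>j. real j * \<bar>gap \<beta> \<alpha> j\<bar>)"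
  proof (rule summable_comparison_test')
    show "summable (\<lambda>j. real (Suc j) * (1 / \<beta>) ^ j)"
      using geometric_deriv_sums[of "1 / \<beta>"] assms by (auto simp: sums_iff)
    fix j
    have "\<bar>gap \<beta> \<alpha> j\<bar> \<le> (1 / \<beta>) ^ j"
      using T_orbit_bounds[of 1 j \<beta> \<alpha>] T_orbit_bounds[of 0 j \<beta> \<alpha>] assms
      by (simp add: gap_def power_one_over divide_simps)
    then have "real j * \<bar>gap \<beta> \<alpha> j\<bar> \<le> real (Suc j) * (1 / \<beta>) ^ j"
      by (intro mult_mono) auto
    then show "norm (real j * \<bar>gap \<beta> \<alpha> j\<bar>) \<le> real (Suc j) * (1 / \<beta>) ^ j"
      by simp
  qed
  then show ?thesis
    by (rule suminf_pos_of_renewal[OF _ _ _ _ conv]) (use q x in auto)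
qed

section \<open>The left-continuous version of the map\<close>

text \<open>
  The value \<open>1 - frac (- u)\<close> is the representative of \<open>u\<close> modulo \<open>1\<close> in \<open>(0,1]\<close>, and the left limit of
  \<^const>\<open>frac\<close> at \<open>u\<close>.
\<close>
definition T_left :: "real \<Rightarrow> real \<Rightarrow> real \<Rightarrow> real" where
  "T_left \<beta> \<alpha> x = 1 - frac (- (\<beta> * x + \<alpha>))"

lemma T_left_bounds: "0 < T_left \<beta> \<alpha> x" "T_left \<beta> \<alpha> x \<le> 1"
  by (auto simp: T_left_def frac_lt_1)

lemma T_left_eq: "T_left \<beta> \<alpha> x = (if T \<beta> \<alpha> x = 0 then 1 else T \<beta> \<alpha> x)"
  using frac_neg[of "\<beta> * x + \<alpha>"] by (auto simp: T_left_def T_def)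

section \<open>Discounted power sums along orbits\<close>

definition orbit_sum :: "(real \<Rightarrow> real) \<Rightarrow> real \<Rightarrow> nat \<Rightarrow> real \<Rightarrow> real" where
  "orbit_sum S \<beta> k x = (\<Sum>n. ((S ^^ n) x) ^ k / \<beta> ^ n)"

definition orbit_gap :: "(real \<Rightarrow> real) \<Rightarrow> real \<Rightarrow> nat \<Rightarrow> real" where
  "orbit_gap S \<beta> k = orbit_sum S \<beta> k 1 - orbit_sum S \<beta> k 0"

lemma orbit_term_bound:
  fixes \<beta> x :: real and S :: "real \<Rightarrow> real"
  assumes "1 < \<beta>" "\<And>y. y \<in> {0..1} \<Longrightarrow> S y \<in> {0..1}" "x \<in> {0..1}"
  shows "\<bar>((S ^^ n) x) ^ k / \<beta> ^ n\<bar> \<le> (1 / \<beta>) ^ n"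
  using funpow_in_invariant[of "{0..1}" S x n, OF assms(2,3)] assms(1)
  by (auto simp: power_one_over divide_simps power_le_one)

lemma summable_orbit:
  fixes \<beta> x :: real and S :: "real \<Rightarrow> real"
  assumes "1 < \<beta>" "\<And>y. y \<in> {0..1} \<Longrightarrow> S y \<in> {0..1}" "x \<in> {0..1}"
  shows "summable (\<lambda>n. ((S ^^ n) x) ^ k / \<beta> ^ n)"
proof (rule summable_comparison_test')
  show "summable (\<lambda>n. (1 / \<beta>) ^ n)"
    using assms by (intro summable_geometric) auto
  show "norm (((S ^^ n) x) ^ k / \<beta> ^ n) \<le> (1 / \<beta>) ^ n" for n
    using orbit_term_bound[OF assms] by simp
qed

lemma orbit_sum_split:
  fixes \<beta> x :: real and S :: "real \<Rightarrow> real"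
  assumes "1 < \<beta>" "\<And>y. y \<in> {0..1} \<Longrightarrow> S y \<in> {0..1}" "x \<in> {0..1}"
  shows "orbit_sum S \<beta> k x = (\<Sum>n<m. ((S ^^ n) x) ^ k / \<beta> ^ n) + (1 / \<beta>) ^ m * orbit_sum S \<beta> k ((S ^^ m) x)"
proof -
  let ?f = "\<lambda>n. ((S ^^ n) x) ^ k / \<beta> ^ n"
  have "(S ^^ m) x \<in> {0..1}"
    by (rule funpow_in_invariant) (use assms in auto)
  then have s: "summable (\<lambda>n. ((S ^^ n) ((S ^^ m) x)) ^ k / \<beta> ^ n)"
    using assms by (intro summable_orbit) auto
  have "orbit_sum S \<beta> k x = (\<Sum>n. ?f (n + m)) + (\<Sum>n<m. ?f n)"
    unfolding orbit_sum_def using assms by (intro suminf_split_initial_segment summable_orbit) auto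
  also have "(\<lambda>n. ?f (n + m)) = (\<lambda>n. (1 / \<beta>) ^ m * (((S ^^ n) ((S ^^ m) x)) ^ k / \<beta> ^ n))"
    by (simp add: funpow_add power_add power_one_over mult.commute)
  finally show ?thesis
    using suminf_mult[OF s, of "(1 / \<beta>) ^ m"] by (simp add: orbit_sum_def)
qed

lemma T_maps: "y \<in> {0..1} \<Longrightarrow> T \<beta> \<alpha> y \<in> {0..1}"
  using T_bounds[of \<beta> \<alpha> y] by auto

lemma T_left_maps: "y \<in> {0..1} \<Longrightarrow> T_left \<beta> \<alpha> y \<in> {0..1}"
  using T_left_bounds[of \<beta> \<alpha> y] by auto

section \<open>Comparing the two versions of the map\<close>

lemma orbits_agree_before_return:
  assumes "\<And>j. 0 < j \<Longrightarrow> j \<le> n \<Longrightarrow> (T \<beta> \<alpha> ^^ j) x \<noteq> 0"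
  shows "(T_left \<beta> \<alpha> ^^ n) x = (T \<beta> \<alpha> ^^ n) x"
  using assms
proof (induction n)
  case (Suc n)
  then have "(T_left \<beta> \<alpha> ^^ n) x = (T \<beta> \<alpha> ^^ n) x" by simp
  then show ?case
    using Suc.prems[of "Suc n"] by (simp add: T_left_eq[of _ _ "(T \<beta> \<alpha> ^^ n) x"])
qed simp

text \<open>
  If the orbit of \<open>x\<close> under \<^const>\<open>T\<close> first hits \<open>0\<close> at time \<open>m > 0\<close>, then the orbit under
  \<^const>\<open>T_left\<close> agrees with it before time \<open>m\<close> and is at \<open>1\<close> at time \<open>m\<close>; both series continue with
  weight \<open>w = \<beta>\<^sup>-\<^sup>m\<close>. If there is no such time, the orbits agree and \<open>w = 0\<close>.
  In either case \<open>w\<close> does not depend on the exponent \<open>k\<close>.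
\<close>
lemma orbit_sums_at_return:
  assumes "1 < \<beta>" "x \<in> {0..1}"
  obtains w C where "0 \<le> w" "w < 1"
    "\<And>k. orbit_sum (T \<beta> \<alpha>) \<beta> k x = C k + w * orbit_sum (T \<beta> \<alpha>) \<beta> k 0"
    "\<And>k. orbit_sum (T_left \<beta> \<alpha>) \<beta> k x = C k + w * orbit_sum (T_left \<beta> \<alpha>) \<beta> k 1"
proof (cases "\<exists>n>0. (T \<beta> \<alpha> ^^ n) x = 0")
  case True
  define m where "m = (LEAST n. 0 < n \<and> (T \<beta> \<alpha> ^^ n) x = 0)"
  have m: "0 < m" "(T \<beta> \<alpha> ^^ m) x = 0"
    using LeastI_ex[OF True] by (auto simp: m_def)
  have "(T \<beta> \<alpha> ^^ j) x \<noteq> 0" if "0 < j" "j < m" for j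
    using that not_less_Least[of j "\<lambda>n. 0 < n \<and> (T \<beta> \<alpha> ^^ n) x = 0"] by (simp add: m_def)
  then have agree: "(T_left \<beta> \<alpha> ^^ n) x = (T \<beta> \<alpha> ^^ n) x" if "n < m" for n
    using that by (intro orbits_agree_before_return) simp
  obtain m' where m': "m = Suc m'"
    using m gr0_implies_Suc by blast
  have ml: "(T_left \<beta> \<alpha> ^^ m) x = 1"
    using agree[of m'] m by (simp add: m' T_left_eq[of _ _ "(T \<beta> \<alpha> ^^ m') x"])
  show ?thesis
  proof (rule that)
    show "0 \<le> (1 / \<beta>) ^ m" "(1 / \<beta>) ^ m < 1"
      using assms m by (auto intro!: power_Suc_less_one simp: m' simp del: power_Suc)
    show "orbit_sum (T \<beta> \<alpha>) \<beta> k x = (\<Sum>n<m. ((T \<beta> \<alpha> ^^ n) x) ^ k / \<beta> ^ n)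
        + (1 / \<beta>) ^ m * orbit_sum (T \<beta> \<alpha>) \<beta> k 0" for k
      using orbit_sum_split[OF assms(1) T_maps assms(2), where m = m] m by simp
    show "orbit_sum (T_left \<beta> \<alpha>) \<beta> k x = (\<Sum>n<m. ((T \<beta> \<alpha> ^^ n) x) ^ k / \<beta> ^ n)
        + (1 / \<beta>) ^ m * orbit_sum (T_left \<beta> \<alpha>) \<beta> k 1" for k
      using orbit_sum_split[OF assms(1) T_left_maps assms(2), where m = m] ml agree by simp
  qed
next
  case False
  then have "(T_left \<beta> \<alpha> ^^ n) x = (T \<beta> \<alpha> ^^ n) x" for n
    by (intro orbits_agree_before_return) blast
  then have "orbit_sum (T_left \<beta> \<alpha>) \<beta> k x = orbit_sum (T \<beta> \<alpha>) \<beta> k x" for k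
    by (simp add: orbit_sum_def)
  then show ?thesis
    using that[of 0 "\<lambda>k. orbit_sum (T \<beta> \<alpha>) \<beta> k x"] by simp
qed

text \<open>
  Let \<open>u\<close> and \<open>v\<close> be the return weights of \<open>0\<close> and \<open>1\<close>, with initial parts \<open>B\<close> and \<open>A\<close>. Solving the
  linear equations of \<open>orbit_sums_at_return\<close> shows that \<open>(1 - u)\<close> times the gap of \<^const>\<open>T\<close> and
  \<open>(1 - v)\<close> times the gap of \<^const>\<open>T_left\<close> are both equal to \<open>(1 - u) A - (1 - v) B\<close>.
\<close>
lemma orbit_gaps_proportional:
  assumes "1 < \<beta>"
  obtains c where "0 < c" "\<And>k. orbit_gap (T_left \<beta> \<alpha>) \<beta> k = c * orbit_gap (T \<beta> \<alpha>) \<beta> k"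
proof -
  obtain u B where u: "0 \<le> u" "u < 1"
    and B: "\<And>k. orbit_sum (T \<beta> \<alpha>) \<beta> k 0 = B k + u * orbit_sum (T \<beta> \<alpha>) \<beta> k 0"
      "\<And>k. orbit_sum (T_left \<beta> \<alpha>) \<beta> k 0 = B k + u * orbit_sum (T_left \<beta> \<alpha>) \<beta> k 1"
    using orbit_sums_at_return[OF assms, of 0 \<alpha>] by auto
  obtain v A where v: "0 \<le> v" "v < 1"
    and A: "\<And>k. orbit_sum (T \<beta> \<alpha>) \<beta> k 1 = A k + v * orbit_sum (T \<beta> \<alpha>) \<beta> k 0"
      "\<And>k. orbit_sum (T_left \<beta> \<alpha>) \<beta> k 1 = A k + v * orbit_sum (T_left \<beta> \<alpha>) \<beta> k 1"
    using orbit_sums_at_return[OF assms, of 1 \<alpha>] by auto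
  show ?thesis
  proof (rule that)
    show "0 < (1 - u) / (1 - v)"
      using u v by simp
    fix k
    have "(1 - v) * orbit_gap (T_left \<beta> \<alpha>) \<beta> k = (1 - u) * A k - (1 - v) * B k"
      unfolding orbit_gap_def using A(2)[of k] B(2)[of k] by algebra
    also have "\<dots> = (1 - u) * orbit_gap (T \<beta> \<alpha>) \<beta> k"
      unfolding orbit_gap_def using A(1)[of k] B(1)[of k] by algebra
    finally show "orbit_gap (T_left \<beta> \<alpha>) \<beta> k = (1 - u) / (1 - v) * orbit_gap (T \<beta> \<alpha>) \<beta> k"
      using v by (simp add: field_simps)
  qed
qed

section \<open>Reflection of the unit interval\<close>

text \<open>
  The reflection turns the right-continuous map into a left-continuous one, so with
  \<^const>\<open>T_left\<close> the conjugation is exact, also at the discontinuities.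
\<close>
lemma T_reflect: "T \<beta> (1 - frac (\<beta> + \<alpha>)) x = 1 - T_left \<beta> \<alpha> (1 - x)"
proof -
  have "\<beta> * x + (1 - frac (\<beta> + \<alpha>)) = - (\<beta> * (1 - x) + \<alpha>) + of_int (1 + \<lfloor>\<beta> + \<alpha>\<rfloor>)"
    by (simp add: frac_def algebra_simps)
  moreover have "frac (y + of_int i) = frac y" for y :: real and i
    by (simp add: frac_def)
  ultimately show ?thesis
    unfolding T_def T_left_def by (simp only:)
qed

lemma T_reflect_orbit:
  "(T \<beta> (1 - frac (\<beta> + \<alpha>)) ^^ n) x = 1 - (T_left \<beta> \<alpha> ^^ n) (1 - x)"
  by (induction n) (auto simp: T_reflect)

text \<open>
  Reflection exchanges the end points \<open>0\<close> and \<open>1\<close>, so it changes the sign of a gap, and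
  \<open>(1 - y)\<^sup>2 = 1 - 2 y + y\<^sup>2\<close>. Constant terms cancel because they contribute equally at both end points.
\<close>
lemma orbit_gap_reflect:
  fixes \<alpha> :: real
  assumes "1 < \<beta>"
  defines "\<alpha>' \<equiv> 1 - frac (\<beta> + \<alpha>)"
  shows "orbit_gap (T \<beta> \<alpha>') \<beta> 1 = orbit_gap (T_left \<beta> \<alpha>) \<beta> 1"
    and "orbit_gap (T \<beta> \<alpha>') \<beta> 2 = 2 * orbit_gap (T_left \<beta> \<alpha>) \<beta> 1 - orbit_gap (T_left \<beta> \<alpha>) \<beta> 2"
proof -
  let ?s = "\<lambda>k x n. ((T_left \<beta> \<alpha> ^^ n) x) ^ k / \<beta> ^ n"
  have S: "?s k x sums orbit_sum (T_left \<beta> \<alpha>) \<beta> k x" if "x \<in> {0..1}" for k x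
    unfolding orbit_sum_def using that assms
    by (intro summable_sums summable_orbit T_left_maps) auto
  have R: "orbit_sum (T \<beta> \<alpha>') \<beta> 1 x = orbit_sum (T_left \<beta> \<alpha>) \<beta> 0 (1 - x) - orbit_sum (T_left \<beta> \<alpha>) \<beta> 1 (1 - x)"
    "orbit_sum (T \<beta> \<alpha>') \<beta> 2 x = orbit_sum (T_left \<beta> \<alpha>) \<beta> 0 (1 - x)
        - 2 * orbit_sum (T_left \<beta> \<alpha>) \<beta> 1 (1 - x) + orbit_sum (T_left \<beta> \<alpha>) \<beta> 2 (1 - x)"
    if "x \<in> {0..1}" for x
  proof -
    have x: "1 - x \<in> {0..1}" using that by auto
    have "(\<lambda>n. ?s 0 (1 - x) n - ?s 1 (1 - x) n) sums
        (orbit_sum (T_left \<beta> \<alpha>) \<beta> 0 (1 - x) - orbit_sum (T_left \<beta> \<alpha>) \<beta> 1 (1 - x))"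
      by (intro sums_diff S x)
    also have "(\<lambda>n. ?s 0 (1 - x) n - ?s 1 (1 - x) n) = (\<lambda>n. ((T \<beta> \<alpha>' ^^ n) x) ^ 1 / \<beta> ^ n)"
      by (simp add: \<alpha>'_def T_reflect_orbit diff_divide_distrib)
    finally show "orbit_sum (T \<beta> \<alpha>') \<beta> 1 x = orbit_sum (T_left \<beta> \<alpha>) \<beta> 0 (1 - x) - orbit_sum (T_left \<beta> \<alpha>) \<beta> 1 (1 - x)"
      unfolding orbit_sum_def[of "T \<beta> \<alpha>'"] by (rule sums_unique[symmetric])
    have "(\<lambda>n. ?s 0 (1 - x) n - 2 * ?s 1 (1 - x) n + ?s 2 (1 - x) n) sums
        (orbit_sum (T_left \<beta> \<alpha>) \<beta> 0 (1 - x) - 2 * orbit_sum (T_left \<beta> \<alpha>) \<beta> 1 (1 - x)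
          + orbit_sum (T_left \<beta> \<alpha>) \<beta> 2 (1 - x))"
      by (intro sums_diff sums_add sums_mult S x)
    also have "(\<lambda>n. ?s 0 (1 - x) n - 2 * ?s 1 (1 - x) n + ?s 2 (1 - x) n) = (\<lambda>n. ((T \<beta> \<alpha>' ^^ n) x) ^ 2 / \<beta> ^ n)"
      unfolding \<alpha>'_def T_reflect_orbit power2_diff
      by (simp add: diff_divide_distrib add_divide_distrib algebra_simps)
    finally show "orbit_sum (T \<beta> \<alpha>') \<beta> 2 x = orbit_sum (T_left \<beta> \<alpha>) \<beta> 0 (1 - x)
        - 2 * orbit_sum (T_left \<beta> \<alpha>) \<beta> 1 (1 - x) + orbit_sum (T_left \<beta> \<alpha>) \<beta> 2 (1 - x)"
      unfolding orbit_sum_def[of "T \<beta> \<alpha>'"] by (rule sums_unique[symmetric])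
  qed
  have 0: "orbit_sum (T_left \<beta> \<alpha>) \<beta> 0 1 = orbit_sum (T_left \<beta> \<alpha>) \<beta> 0 0"
    by (simp add: orbit_sum_def)
  show "orbit_gap (T \<beta> \<alpha>') \<beta> 1 = orbit_gap (T_left \<beta> \<alpha>) \<beta> 1"
    "orbit_gap (T \<beta> \<alpha>') \<beta> 2 = 2 * orbit_gap (T_left \<beta> \<alpha>) \<beta> 1 - orbit_gap (T_left \<beta> \<alpha>) \<beta> 2"
    unfolding orbit_gap_def using R[of 0] R[of 1] 0 by simp_all
qed

section \<open>One-sided limits in the translation parameter\<close>

text \<open>
  Convergence alone does not survive an application of the discontinuous map; the induction
  also needs that the limit is approached from above. An iterate is a monotone function of \<open>\<alpha>\<close> as long as
  the integer parts of the previous steps do not change, and \<^const>\<open>frac\<close> is right-continuous.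
\<close>
lemma orbit_tendsto_at_right:
  assumes "1 < \<beta>"
  shows "((\<lambda>\<alpha>. (T \<beta> \<alpha> ^^ n) x) \<longlongrightarrow> (T \<beta> \<alpha>\<^sub>0 ^^ n) x) (at_right \<alpha>\<^sub>0) \<and>
    (\<forall>\<^sub>F \<alpha> in at_right \<alpha>\<^sub>0. (T \<beta> \<alpha>\<^sub>0 ^^ n) x \<le> (T \<beta> \<alpha> ^^ n) x)"
proof (induction n)
  case (Suc n)
  define y y0 where "y \<alpha> = \<beta> * (T \<beta> \<alpha> ^^ n) x + \<alpha>" and "y0 = y \<alpha>\<^sub>0" for \<alpha>
  have lim: "(y \<longlongrightarrow> y0) (at_right \<alpha>\<^sub>0)"
    unfolding y_def y0_def by (intro tendsto_intros Suc[THEN conjunct1])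
  have ge: "\<forall>\<^sub>F \<alpha> in at_right \<alpha>\<^sub>0. y0 \<le> y \<alpha>"
    using Suc[THEN conjunct2] eventually_at_right_less[of \<alpha>\<^sub>0]
    by eventually_elim (use assms in \<open>auto simp: y_def y0_def intro!: add_mono mult_left_mono\<close>)
  have "y0 < of_int \<lfloor>y0\<rfloor> + 1"
    by linarith
  then have "\<forall>\<^sub>F \<alpha> in at_right \<alpha>\<^sub>0. y \<alpha> < of_int \<lfloor>y0\<rfloor> + 1"
    by (rule order_tendstoD(2)[OF lim])
  with ge have "\<forall>\<^sub>F \<alpha> in at_right \<alpha>\<^sub>0. \<lfloor>y \<alpha>\<rfloor> = \<lfloor>y0\<rfloor>"
    by eventually_elim (auto intro!: floor_unique intro: order_trans[OF of_int_floor_le])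
  then have eq: "\<forall>\<^sub>F \<alpha> in at_right \<alpha>\<^sub>0. (T \<beta> \<alpha> ^^ Suc n) x = y \<alpha> - of_int \<lfloor>y0\<rfloor>"
    by eventually_elim (simp add: T_def frac_def y_def)
  have eq0: "(T \<beta> \<alpha>\<^sub>0 ^^ Suc n) x = y0 - of_int \<lfloor>y0\<rfloor>"
    by (simp add: T_def frac_def y_def y0_def)
  have "((\<lambda>\<alpha>. y \<alpha> - of_int \<lfloor>y0\<rfloor>) \<longlongrightarrow> y0 - of_int \<lfloor>y0\<rfloor>) (at_right \<alpha>\<^sub>0)"
    by (intro tendsto_intros lim)
  moreover have "\<forall>\<^sub>F \<alpha> in at_right \<alpha>\<^sub>0. (T \<beta> \<alpha>\<^sub>0 ^^ Suc n) x \<le> (T \<beta> \<alpha> ^^ Suc n) x"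
    using eq ge unfolding eq0 by eventually_elim simp
  ultimately show ?case
    using eq unfolding eq0 by (auto simp: tendsto_cong)
qed simp

text \<open>
  Here the approach is from below, and strictly so after adding \<open>\<alpha> < \<alpha>\<^sub>0\<close>. Therefore the integer part near
  the limit \<open>y0\<close> is \<open>\<lceil>y0\<rceil> - 1\<close>, also when \<open>y0\<close> is an integer, and this is the integer part
  used by \<^const>\<open>T_left\<close>.
\<close>
lemma orbit_tendsto_at_left:
  assumes "1 < \<beta>"
  shows "((\<lambda>\<alpha>. (T \<beta> \<alpha> ^^ n) x) \<longlongrightarrow> (T_left \<beta> \<alpha>\<^sub>0 ^^ n) x) (at_left \<alpha>\<^sub>0) \<and>
    (\<forall>\<^sub>F \<alpha> in at_left \<alpha>\<^sub>0. (T \<beta> \<alpha> ^^ n) x \<le> (T_left \<beta> \<alpha>\<^sub>0 ^^ n) x)"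
proof (induction n)
  case (Suc n)
  define y y0 where "y \<alpha> = \<beta> * (T \<beta> \<alpha> ^^ n) x + \<alpha>" 
    and "y0 = \<beta> * (T_left \<beta> \<alpha>\<^sub>0 ^^ n) x + \<alpha>\<^sub>0" for \<alpha>
  have lim: "(y \<longlongrightarrow> y0) (at_left \<alpha>\<^sub>0)"
    unfolding y_def y0_def by (intro tendsto_intros Suc[THEN conjunct1])
  have below: "\<forall>\<^sub>F \<alpha> in at_left \<alpha>\<^sub>0. \<alpha> < \<alpha>\<^sub>0"
    by (simp add: eventually_at_filter)
  have less: "\<forall>\<^sub>F \<alpha> in at_left \<alpha>\<^sub>0. y \<alpha> < y0"
    using Suc[THEN conjunct2] below
    by eventually_elim (use assms in \<open>auto simp: y_def y0_def intro!: add_le_less_mono mult_left_mono\<close>)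
  have "of_int (\<lceil>y0\<rceil> - 1) < y0"
    by linarith
  then have "\<forall>\<^sub>F \<alpha> in at_left \<alpha>\<^sub>0. of_int (\<lceil>y0\<rceil> - 1) < y \<alpha>"
    by (rule order_tendstoD(1)[OF lim])
  with less have "\<forall>\<^sub>F \<alpha> in at_left \<alpha>\<^sub>0. \<lfloor>y \<alpha>\<rfloor> = \<lceil>y0\<rceil> - 1"
    by eventually_elim (rule floor_unique, auto intro: less_le_trans[OF _ le_of_int_ceiling])
  then have eq: "\<forall>\<^sub>F \<alpha> in at_left \<alpha>\<^sub>0. (T \<beta> \<alpha> ^^ Suc n) x = y \<alpha> - of_int (\<lceil>y0\<rceil> - 1)"
    by eventually_elim (simp add: T_def frac_def y_def)
  have eq0: "(T_left \<beta> \<alpha>\<^sub>0 ^^ Suc n) x = y0 - of_int (\<lceil>y0\<rceil> - 1)"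
    by (simp add: T_left_def frac_def y0_def ceiling_def)
  have "((\<lambda>\<alpha>. y \<alpha> - of_int (\<lceil>y0\<rceil> - 1)) \<longlongrightarrow> y0 - of_int (\<lceil>y0\<rceil> - 1)) (at_left \<alpha>\<^sub>0)"
    by (intro tendsto_intros lim)
  moreover have "\<forall>\<^sub>F \<alpha> in at_left \<alpha>\<^sub>0. (T \<beta> \<alpha> ^^ Suc n) x \<le> (T_left \<beta> \<alpha>\<^sub>0 ^^ Suc n) x"
    using eq less unfolding eq0 by eventually_elim simp
  ultimately show ?case
    using eq unfolding eq0 by (auto simp: tendsto_cong)
qed simp

lemma orbit_sum_tendsto:
  assumes "1 < \<beta>" "x \<in> {0..1}" "F \<noteq> bot"
    and lim: "\<And>n. ((\<lambda>\<alpha>. (T \<beta> \<alpha> ^^ n) x) \<longlongrightarrow> (S ^^ n) x) F"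
  shows "((\<lambda>\<alpha>. orbit_sum (T \<beta> \<alpha>) \<beta> k x) \<longlongrightarrow> orbit_sum S \<beta> k x) F"
  unfolding orbit_sum_def
proof (rule tannerys_theorem[THEN conjunct2, THEN conjunct2])
  show "((\<lambda>\<alpha>. ((T \<beta> \<alpha> ^^ n) x) ^ k / \<beta> ^ n) \<longlongrightarrow> ((S ^^ n) x) ^ k / \<beta> ^ n) F" for n
    using assms(1) by (intro tendsto_intros lim) auto
  show "\<forall>\<^sub>F (n, \<alpha>) in at_top \<times>\<^sub>F F. norm (((T \<beta> \<alpha> ^^ n) x) ^ k / \<beta> ^ n) \<le> (1 / \<beta>) ^ n"
    using orbit_term_bound[OF assms(1) T_maps assms(2)] by (intro always_eventually) auto
  show "summable (\<lambda>n. (1 / \<beta>) ^ n)"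
    using assms by (intro summable_geometric) auto
qed fact

lemma orbit_gap_tendsto_at_right:
  assumes "1 < \<beta>"
  shows "((\<lambda>\<alpha>. orbit_gap (T \<beta> \<alpha>) \<beta> k) \<longlongrightarrow> orbit_gap (T \<beta> \<alpha>\<^sub>0) \<beta> k) (at_right \<alpha>\<^sub>0)"
  unfolding orbit_gap_def using assms orbit_tendsto_at_right[OF assms]
  by (intro tendsto_diff orbit_sum_tendsto) auto

lemma orbit_gap_tendsto_at_left:
  assumes "1 < \<beta>"
  shows "((\<lambda>\<alpha>. orbit_gap (T \<beta> \<alpha>) \<beta> k) \<longlongrightarrow> orbit_gap (T_left \<beta> \<alpha>\<^sub>0) \<beta> k) (at_left \<alpha>\<^sub>0)"
  unfolding orbit_gap_def using assms orbit_tendsto_at_left[OF assms]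
  by (intro tendsto_diff orbit_sum_tendsto) auto

section \<open>The mean as a ratio of discounted sums\<close>

lemma orbit_gap_1_pos:
  assumes "1 < \<beta>"
  shows "0 < orbit_gap (T \<beta> \<alpha>) \<beta> 1"
proof -
  have "summable (\<lambda>n. ((T \<beta> \<alpha> ^^ n) x) ^ 1 / \<beta> ^ n)" if "x \<in> {0..1}" for x
    by (intro summable_orbit assms T_maps that)
  from this[of 0] this[of 1] have "orbit_gap (T \<beta> \<alpha>) \<beta> 1 = (\<Sum>n. gap \<beta> \<alpha> n)"
    by (simp add: orbit_gap_def orbit_sum_def gap_def suminf_diff diff_divide_distrib)
  with suminf_gap_pos[OF assms] show ?thesis by simp
qed

text \<open>The half-open segment of \<^const>\<open>g_tilde\<close> and the closed one of \<open>integral_power\<close> differ by a point.\<close>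
lemma integral_power_initial_segment:
  fixes a :: real
  assumes "a \<in> {0..1}"
  shows "integrable lborel (\<lambda>x. indicator {0..1} x * x ^ k * indicator {..<a} x)" (is ?i)
    and "(\<integral>x. indicator {0..1} x * x ^ k * indicator {..<a} x \<partial>lborel) = a ^ Suc k / Suc k" (is ?v)
proof -
  let ?f = "\<lambda>x. indicator {0..1} x * x ^ k * indicator {..<a} x :: real"
  let ?h = "\<lambda>x. x ^ k * indicator {0..a} x :: real"
  have ae: "AE x in lborel. ?f x = ?h x"
    using AE_lborel_singleton[of a]
    by eventually_elim (use assms in \<open>auto simp: indicator_def\<close>)
  have "integrable lborel ?h"
    using borel_integrable_atLeastAtMost[of 0 a "\<lambda>x. x ^ k"]
    by (simp add: mult.commute)
  moreover have m: "?f \<in> borel_measurable lborel" "?h \<in> borel_measurable lborel"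
    by measurable
  ultimately show ?i
    using ae integrable_cong_AE by blast
  have "integral\<^sup>L lborel ?f = integral\<^sup>L lborel ?h"
    using ae m by (intro integral_cong_AE)
  also have "\<dots> = a ^ Suc k / Suc k"
    using integral_power[of 0 a k] assms by simp
  finally show ?v .
qed

lemma infsum_weights_eq_suminf:
  assumes "1 < \<beta>"
  shows "(\<Sum>\<^sub>\<infinity>n\<in>{n. x < s n}. 1 / \<beta> ^ n) = (\<Sum>n. indicator {..<s n} x / \<beta> ^ n :: real)"
    and "summable (\<lambda>n. indicator {..<s n} x / \<beta> ^ n :: real)"
proof -
  let ?f = "\<lambda>n. indicator {..<s n} x / \<beta> ^ n :: real"
  show s: "summable ?f"
  proof (rule summable_comparison_test')
    show "summable (\<lambda>n. (1 / \<beta>) ^ n)"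
      using assms by (intro summable_geometric) auto
    show "norm (?f n) \<le> (1 / \<beta>) ^ n" for n
      using assms by (auto simp: indicator_def power_one_over)
  qed
  then have "(?f has_sum suminf ?f) UNIV"
    using assms by (intro norm_summable_imp_has_sum) auto
  also have "?this \<longleftrightarrow> ((\<lambda>n. 1 / \<beta> ^ n) has_sum suminf ?f) {n. x < s n}"
    by (intro has_sum_cong_neutral) auto
  finally show "(\<Sum>\<^sub>\<infinity>n\<in>{n. x < s n}. 1 / \<beta> ^ n) = suminf ?f"
    by (rule infsumI)
qed

lemma integral_power_g_tilde:
  assumes "1 < \<beta>"
  shows "(LINT x:{0..1}|lebesgue. x ^ k * g_tilde \<beta> \<alpha> x) = orbit_gap (T \<beta> \<alpha>) \<beta> (Suc k) / Suc k"
proof -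
  let ?a = "\<lambda>n. (T \<beta> \<alpha> ^^ n) 1" and ?b = "\<lambda>n. (T \<beta> \<alpha> ^^ n) 0"
  let ?w = "\<lambda>c x. indicator {0..1} x * x ^ k * indicator {..<c} x :: real"
  define f where "f n x = (?w (?a n) x - ?w (?b n) x) / \<beta> ^ n" for n x
  have ab: "?a n \<in> {0..1}" "?b n \<in> {0..1}" for n
    using T_orbit_bounds[of 1 n \<beta> \<alpha>] T_orbit_bounds[of 0 n \<beta> \<alpha>] by auto
  have g: "indicator {0..1} x * (x ^ k * g_tilde \<beta> \<alpha> x) = (\<Sum>n. f n x)" for x
  proof -
    have s: "summable (\<lambda>n. indicator {..<?a n} x / \<beta> ^ n :: real)"
      "summable (\<lambda>n. indicator {..<?b n} x / \<beta> ^ n :: real)"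
      by (rule infsum_weights_eq_suminf(2)[OF assms])+
    have "g_tilde \<beta> \<alpha> x = (\<Sum>n. indicator {..<?a n} x / \<beta> ^ n - indicator {..<?b n} x / \<beta> ^ n)"
      unfolding g_tilde_def infsum_weights_eq_suminf(1)[OF assms] by (rule suminf_diff[OF s])
    then have "indicator {0..1} x * (x ^ k * g_tilde \<beta> \<alpha> x) =
        (\<Sum>n. indicator {0..1} x * x ^ k * (indicator {..<?a n} x / \<beta> ^ n - indicator {..<?b n} x / \<beta> ^ n))"
      using suminf_mult[OF summable_diff[OF s], of "indicator {0..1} x * x ^ k"] by simp
    also have "\<dots> = (\<Sum>n. f n x)"
      by (simp add: f_def diff_divide_distrib right_diff_distrib)
    finally show ?thesis .
  qed
  have bound: "norm (f n x) \<le> indicator {0..1} x * (1 / \<beta>) ^ n" for n x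
    using assms by (auto simp: f_def indicator_def power_one_over divide_simps power_le_one)
  have int: "integrable lborel (f n)" for n
    unfolding f_def[abs_def]
    by (intro integrable_divide_zero Bochner_Integration.integrable_diff
        integral_power_initial_segment(1) ab)
  have geo: "summable (\<lambda>n. (1 / \<beta>) ^ n)"
    using assms by (intro summable_geometric) auto
  have sf: "summable (\<lambda>n. norm (f n x))" for x
    by (rule summable_comparison_test'[OF summable_mult[OF geo, of "indicator {0..1} x"]])
       (use bound in auto)
  have si: "summable (\<lambda>n. \<integral>x. norm (f n x) \<partial>lborel)"
  proof (rule summable_comparison_test'[OF geo])
    fix n
    have "(\<integral>x. norm (f n x) \<partial>lborel) \<le> (\<integral>x. indicator {0..1::real} x * (1 / \<beta>) ^ n \<partial>lborel)"
      using bound int by (intro integral_mono) (auto intro!: integrable_norm)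
    then show "norm (\<integral>x. norm (f n x) \<partial>lborel) \<le> (1 / \<beta>) ^ n"
      by simp
  qed
  have meas: "(\<lambda>x. \<Sum>n. f n x) \<in> borel_measurable lborel"
    using int by (intro borel_measurable_suminf) auto
  have "(LINT x:{0..1}|lebesgue. x ^ k * g_tilde \<beta> \<alpha> x) = (\<integral>x. (\<Sum>n. f n x) \<partial>lebesgue)"
    by (simp add: set_lebesgue_integral_def g)
  also have "\<dots> = (\<integral>x. (\<Sum>n. f n x) \<partial>lborel)"
    by (rule integral_completion[OF meas])
  also have "\<dots> = (\<Sum>n. \<integral>x. f n x \<partial>lborel)"
    by (intro integral_suminf int si AE_I2 sf)
  also have "\<dots> = (\<Sum>n. (?a n ^ Suc k / \<beta> ^ n - ?b n ^ Suc k / \<beta> ^ n) / Suc k)"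
  proof (rule suminf_cong)
    fix n
    have "(\<integral>x. f n x \<partial>lborel) =
        ((\<integral>x. ?w (?a n) x \<partial>lborel) - (\<integral>x. ?w (?b n) x \<partial>lborel)) / \<beta> ^ n"
      unfolding f_def integral_divide_zero
      by (subst Bochner_Integration.integral_diff) (rule integral_power_initial_segment(1) ab refl)+
    then show "(\<integral>x. f n x \<partial>lborel) = (?a n ^ Suc k / \<beta> ^ n - ?b n ^ Suc k / \<beta> ^ n) / Suc k"
      unfolding integral_power_initial_segment(2)[OF ab(1)] integral_power_initial_segment(2)[OF ab(2)]
      by (simp add: diff_divide_distrib mult.commute del: power_Suc of_nat_Suc)
  qed
  also have "\<dots> = orbit_gap (T \<beta> \<alpha>) \<beta> (Suc k) / Suc k"
  proof -
    have s: "summable (\<lambda>n. ?a n ^ Suc k / \<beta> ^ n)" "summable (\<lambda>n. ?b n ^ Suc k / \<beta> ^ n)"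
      by (rule summable_orbit[OF assms T_maps]; simp)+
    show ?thesis
      unfolding orbit_gap_def orbit_sum_def suminf_diff[OF s]
      by (rule suminf_divide[OF summable_diff[OF s]])
  qed
  finally show ?thesis .
qed

lemma M_eq_orbit_gap_ratio:
  assumes "1 < \<beta>"
  shows "M \<beta> \<alpha> = orbit_gap (T \<beta> \<alpha>) \<beta> 2 / orbit_gap (T \<beta> \<alpha>) \<beta> 1 / 2"
proof -
  have D: "(LINT y:{0..1}|lebesgue. g_tilde \<beta> \<alpha> y) = orbit_gap (T \<beta> \<alpha>) \<beta> 1"
    using integral_power_g_tilde[OF assms, of 0 \<alpha>] by simp
  have "M \<beta> \<alpha> = (LINT x:{0..1}|lebesgue. x * g_tilde \<beta> \<alpha> x / orbit_gap (T \<beta> \<alpha>) \<beta> 1)"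
    by (simp add: M_def g_def D)
  also have "\<dots> = (LINT x:{0..1}|lebesgue. x * g_tilde \<beta> \<alpha> x) / orbit_gap (T \<beta> \<alpha>) \<beta> 1"
    by (rule set_integral_divide_zero)
  also have "(LINT x:{0..1}|lebesgue. x * g_tilde \<beta> \<alpha> x) = orbit_gap (T \<beta> \<alpha>) \<beta> 2 / 2"
    using integral_power_g_tilde[OF assms, of 1 \<alpha>] by (simp add: numeral_2_eq_2)
  finally show ?thesis
    by simp
qed

lemma M_eq_orbit_gap_ratio_left:
  assumes "1 < \<beta>"
  shows "M \<beta> \<alpha> = orbit_gap (T_left \<beta> \<alpha>) \<beta> 2 / orbit_gap (T_left \<beta> \<alpha>) \<beta> 1 / 2"
proof -
  obtain c where "0 < c" "\<And>k. orbit_gap (T_left \<beta> \<alpha>) \<beta> k = c * orbit_gap (T \<beta> \<alpha>) \<beta> k"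
    using orbit_gaps_proportional[OF assms, of \<alpha>] by blast
  then show ?thesis
    unfolding M_eq_orbit_gap_ratio[OF assms] by simp
qed

lemma orbit_gap_left_1_pos:
  assumes "1 < \<beta>"
  shows "0 < orbit_gap (T_left \<beta> \<alpha>) \<beta> 1"
proof -
  obtain c where "0 < c" "\<And>k. orbit_gap (T_left \<beta> \<alpha>) \<beta> k = c * orbit_gap (T \<beta> \<alpha>) \<beta> k"
    using orbit_gaps_proportional[OF assms, of \<alpha>] by blast
  then show ?thesis
    using orbit_gap_1_pos[OF assms, of \<alpha>] by (metis mult_pos_pos)
qed

section \<open>Continuity and symmetry of the mean\<close>

text \<open>
  The limit from the left is the ratio for \<^const>\<open>T_left\<close>, which is the same number as the ratio for
  \<^const>\<open>T\<close>.
\<close>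
lemma isCont_M:
  assumes "1 < \<beta>"
  shows "isCont (M \<beta>) \<alpha>"
proof -
  have "(M \<beta> \<longlongrightarrow> M \<beta> \<alpha>) (at_right \<alpha>)"
    unfolding M_eq_orbit_gap_ratio[OF assms, abs_def]
    using orbit_gap_1_pos[OF assms, of \<alpha>]
    by (intro tendsto_intros orbit_gap_tendsto_at_right assms) auto
  moreover have "(M \<beta> \<longlongrightarrow> M \<beta> \<alpha>) (at_left \<alpha>)"
    unfolding M_eq_orbit_gap_ratio_left[OF assms, of \<alpha>]
    unfolding M_eq_orbit_gap_ratio[OF assms, abs_def]
    using orbit_gap_left_1_pos[OF assms, of \<alpha>]
    by (intro tendsto_intros orbit_gap_tendsto_at_left assms) auto
  ultimately show ?thesis
    by (simp add: isCont_def filterlim_split_at)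
qed

lemma M_reflect:
  assumes "1 < \<beta>"
  shows "M \<beta> \<alpha> + M \<beta> (1 - frac (\<beta> + \<alpha>)) = 1"
proof -
  let ?L = "orbit_gap (T_left \<beta> \<alpha>) \<beta>"
  have "M \<beta> (1 - frac (\<beta> + \<alpha>)) = (2 * ?L 1 - ?L 2) / ?L 1 / 2"
    unfolding M_eq_orbit_gap_ratio[OF assms] orbit_gap_reflect[OF assms] ..
  also have "\<dots> = 1 - ?L 2 / ?L 1 / 2"
    using orbit_gap_left_1_pos[OF assms, of \<alpha>] by (simp add: diff_divide_distrib)
  finally show ?thesis
    unfolding M_eq_orbit_gap_ratio_left[OF assms, of \<alpha>] by simp
qed

theorem theorem1p2:
  fixes \<beta> :: real
  assumes "\<beta> > sqrt 2"
  shows "continuous_on {0..<1} (M \<beta>) \<and>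
         (\<forall>\<alpha>\<in>{0..<1}. M \<beta> \<alpha> + M \<beta> (1 - frac (\<beta> + \<alpha>)) = 1)"
proof -
  have \<beta>: "1 < \<beta>"
    by (rule less_trans[OF _ assms]) simp
  then show ?thesis
    by (auto intro!: continuous_at_imp_continuous_on isCont_M M_reflect)
qed

end
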